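(* Let $f(z)=z-\frac{6i}{\pi E_2(z)}$, write $f=u+iv$ with $u,v$ real-valued, and let $A=\{z\in\overline{\mathcal{F}}: v(z)=0\}$. Then $f(A)=[-\tfrac12,\tfrac12]$.
   Context: $E_2(z)=1-24\sum_{n\ge1}\frac{nq^n}{1-q^n}$, $q=e^{2\pi i z}$, for $z$ in the upper half plane $\mathbb{H}$. The strict fundamental domain is $\mathcal{F}=\{z\in\mathbb{H}: |z|>1,\ |\mathrm{Re}\,z|<\tfrac12\}\cup\{z\in\mathbb{H}: |z|\ge1,\ -\tfrac12\le\mathrm{Re}\,z\le0\}$, and $\overline{\mathcal{F}}$ is its closure in $\mathbb{H}$. ($E_2$ does not vanish on $\{\mathrm{Im}\,z>0.53\}\supset\overline{\mathcal{F}}$, so $f$ is defined and analytic there.) *)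

theory Defs
  imports "HOL-Complex_Analysis.Complex_Analysis"
begin

definition upper_half_plane :: "complex set" where
  "upper_half_plane = {z. Im z > 0}"

text \<open>The sum over \<open>n \<ge> 1\<close> is written as a series over \<open>Suc n\<close>. The value is only meaningful
  for \<open>z\<close> in the upper half plane, where the series converges absolutely.\<close>

definition E2 :: "complex \<Rightarrow> complex" where
  "E2 z = (let q = exp (2 * of_real pi * \<i> * z)
           in 1 - 24 * (\<Sum>n. of_nat (Suc n) * q ^ Suc n / (1 - q ^ Suc n)))"

definition fund_dom :: "complex set" where
  "fund_dom = {z \<in> upper_half_plane. norm z > 1 \<and> \<bar>Re z\<bar> < 1/2} \<union>
              {z \<in> upper_half_plane. norm z \<ge> 1 \<and> -1/2 \<le> Re z \<and> Re z \<le> 0}"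

definition fund_dom_closure :: "complex set" where
  "fund_dom_closure = top_of_set upper_half_plane closure_of fund_dom"

text \<open>Where \<^term>\<open>E2\<close> vanishes this takes the junk value \<open>z\<close>; there are no zeros
  of \<^term>\<open>E2\<close> in \<^term>\<open>fund_dom_closure\<close>.\<close>

definition f_E2 :: "complex \<Rightarrow> complex" where
  "f_E2 z = z - 6 * \<i> / (of_real pi * E2 z)"

definition A_set :: "complex set" where
  "A_set = {z \<in> fund_dom_closure. Im (f_E2 z) = 0}"

end

theory Submission
  imports Defs
begin

text \<open>
  Write \<open>f(z) = z + g(z)\<close> with \<open>g = -6i / (\<pi> E\<^sub>2)\<close>. On the closed fundamental domain
  \<open>E\<^sub>2\<close> is so close to \<open>1\<close> that \<open>Im f(z) = 0\<close> forces \<open>Im z \<ge> 3/2\<close>. On \<open>Im z \<ge> 3/2\<close> the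
  nome \<open>q\<close> is tiny and \<open>g\<close> is a contraction; moreover \<open>E\<^sub>2\<close> is real, so \<open>Re g = 0\<close>, on the lines
  \<open>Re z = \<plusminus>1/2\<close>. Comparing \<open>z\<close> with the point of the same height on such a line shows that
  \<open>Re f(z)\<close> lies in \<open>[-1/2, 1/2]\<close> if and only if \<open>Re z\<close> does. Surjectivity follows because for
  real \<open>t\<close> the equation \<open>f(z) = t\<close> is the fixed point equation \<open>z = t - g(z)\<close>, and the right hand
  side is a contraction of \<open>{Im z \<ge> 3/2}\<close> into itself.
\<close>

section \<open>The Lambert series of the divisor sum\<close>

text \<open>Kept as a function of a free \<open>q\<close>, so that the sums at two values of the
  nome can be compared. Index \<open>n\<close> carries the exponent \<open>Suc n\<close>.\<close>

definition lambert_term :: "nat \<Rightarrow> complex \<Rightarrow> complex" where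
  "lambert_term n q = of_nat (Suc n) * q ^ Suc n / (1 - q ^ Suc n)"

definition nome :: "complex \<Rightarrow> complex" where
  "nome z = exp (2 * of_real pi * \<i> * z)"

lemma E2_eq_lambert: "E2 z = 1 - 24 * (\<Sum>n. lambert_term n (nome z))"
  by (simp add: E2_def lambert_term_def nome_def Let_def)

lemma norm_one_minus_power_ge:
  fixes q :: complex
  assumes "norm q \<le> r" "r < 1"
  shows "1 - r \<le> norm (1 - q ^ Suc n)"
proof -
  have "norm (q ^ Suc n) = norm q * norm q ^ n"
    by (simp add: norm_power norm_mult)
  also have "\<dots> \<le> r * 1"
    using assms order_trans[OF norm_ge_zero assms(1)] by (intro mult_mono power_le_one) auto
  finally have "norm (q ^ Suc n) \<le> r" by simp
  thus ?thesis
    using norm_triangle_ineq2[of 1 "q ^ Suc n"] by simp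
qed

lemma Suc_le_two_power: "real (Suc n) \<le> 2 ^ n"
  by (induction n) auto

text \<open>The coefficient \<open>Suc n\<close> is absorbed into \<open>2 ^ n\<close>, which leaves
  a geometric bound of ratio \<open>2 * r\<close>; this is crude, but enough for a small
  nome.\<close>

lemma norm_lambert_term_le:
  assumes "norm q \<le> r" "r < 1"
  shows "norm (lambert_term n q) \<le> r / (1 - r) * (2 * r) ^ n"
proof -
  have r: "0 \<le> r" using assms(1) norm_ge_zero order_trans by blast
  have "norm (lambert_term n q) = real (Suc n) * norm q ^ Suc n / norm (1 - q ^ Suc n)"
    by (simp add: lambert_term_def norm_mult norm_divide norm_power del: of_nat_Suc power_Suc)
  also have "\<dots> \<le> 2 ^ n * r ^ Suc n / (1 - r)"
    using assms r norm_one_minus_power_ge[OF assms] Suc_le_two_power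
    by (intro frac_le mult_mono power_mono) auto
  also have "\<dots> = r / (1 - r) * (2 * r) ^ n"
    by (simp add: power_mult_distrib)
  finally show ?thesis .
qed

lemma norm_power_diff_le:
  fixes p q :: complex
  assumes "norm p \<le> r" "norm q \<le> r"
  shows "norm (p ^ Suc n - q ^ Suc n) \<le> real (Suc n) * r ^ n * norm (p - q)"
proof (induction n)
  case 0
  show ?case by simp
next
  case (Suc n)
  have r: "0 \<le> r" using assms(1) norm_ge_zero order_trans by blast
  have "p ^ Suc (Suc n) - q ^ Suc (Suc n) = p * (p ^ Suc n - q ^ Suc n) + q ^ Suc n * (p - q)"
    by (simp add: algebra_simps)
  also have "norm \<dots> \<le> norm p * norm (p ^ Suc n - q ^ Suc n) + norm q ^ Suc n * norm (p - q)"
    by (metis norm_triangle_ineq norm_mult norm_power)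
  also have "\<dots> \<le> r * (real (Suc n) * r ^ n * norm (p - q)) + r ^ Suc n * norm (p - q)"
    using assms r Suc.IH by (intro add_mono mult_mono power_mono) auto
  also have "\<dots> = real (Suc (Suc n)) * r ^ Suc n * norm (p - q)"
    by (simp add: algebra_simps)
  finally show ?case .
qed

lemma norm_lambert_term_diff_le:
  assumes "norm p \<le> r" "norm q \<le> r" "r < 1"
  shows "norm (lambert_term n p - lambert_term n q) \<le> norm (p - q) / (1 - r)\<^sup>2 * (4 * r) ^ n"
proof -
  have r: "0 \<le> r" using assms(1) norm_ge_zero order_trans by blast
  define N where "N = Suc n"
  have p: "1 - r \<le> norm (1 - p ^ N)" and q: "1 - r \<le> norm (1 - q ^ N)"
    using norm_one_minus_power_ge assms unfolding N_def by blast+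
  hence nz: "1 - p ^ N \<noteq> 0" "1 - q ^ N \<noteq> 0" using assms(3) by auto
  \<comment> \<open>The identity x/(1-x) - y/(1-y) = (x-y)/((1-x)(1-y)). The factor \<open>N\<close>
    occurs once here and once more in the bound for the difference of powers, hence the ratio
    \<open>4 * r\<close>.\<close>
  have "lambert_term n p - lambert_term n q = of_nat N * (p ^ N - q ^ N) / ((1 - p ^ N) * (1 - q ^ N))"
    using nz unfolding lambert_term_def N_def[symmetric] by (simp add: divide_simps) (simp add: algebra_simps)
  hence "norm (lambert_term n p - lambert_term n q)
      = real N * norm (p ^ N - q ^ N) / (norm (1 - p ^ N) * norm (1 - q ^ N))"
    by (simp add: norm_mult norm_divide)
  also have "\<dots> \<le> 2 ^ n * (2 ^ n * r ^ n * norm (p - q)) / ((1 - r) * (1 - r))"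
  proof (intro frac_le mult_mono)
    show "real N \<le> 2 ^ n" using Suc_le_two_power N_def by simp
    have "norm (p ^ N - q ^ N) \<le> real (Suc n) * r ^ n * norm (p - q)"
      using norm_power_diff_le[OF assms(1,2)] N_def by simp
    also have "\<dots> \<le> 2 ^ n * r ^ n * norm (p - q)"
      using r Suc_le_two_power by (intro mult_right_mono) auto
    finally show "norm (p ^ N - q ^ N) \<le> 2 ^ n * r ^ n * norm (p - q)" .
  qed (use p q r assms in auto)
  also have "\<dots> = norm (p - q) / (1 - r)\<^sup>2 * (4 * r) ^ n"
    by (simp add: power2_eq_square power_mult_distrib flip: mult.assoc)
       (simp add: mult_ac flip: power_mult_distrib)
  finally show ?thesis .
qed

lemma summable_norm_lambert:
  assumes "norm q \<le> r" "r < 1/2"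
  shows "summable (\<lambda>n. norm (lambert_term n q))"
proof -
  have "0 \<le> r" using assms(1) norm_ge_zero order_trans by blast
  hence "summable (\<lambda>n. r / (1 - r) * (2 * r) ^ n)"
    using assms by (intro summable_mult summable_geometric) auto
  thus ?thesis
    using norm_lambert_term_le[OF assms(1)] assms(2)
    by (elim summable_comparison_test[rotated]) auto
qed

lemma norm_lambert_le:
  assumes "norm q \<le> r" "r < 1/2"
  shows "norm (\<Sum>n. lambert_term n q) \<le> r / ((1 - r) * (1 - 2 * r))"
proof -
  have r: "0 \<le> r" using assms(1) norm_ge_zero order_trans by blast
  have "(\<lambda>n. r / (1 - r) * (2 * r) ^ n) sums (r / (1 - r) * (1 / (1 - 2 * r)))"
    using assms r by (intro sums_mult geometric_sums) auto
  hence "norm (\<Sum>n. lambert_term n q) \<le> r / (1 - r) * (1 / (1 - 2 * r))"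
    using norm_suminf_le[of "\<lambda>n. lambert_term n q", OF norm_lambert_term_le[OF assms(1)]] assms(2)
    unfolding sums_iff by simp
  thus ?thesis by simp
qed

lemma norm_lambert_diff_le:
  assumes "norm p \<le> r" "norm q \<le> r" "r < 1/4"
  shows "norm ((\<Sum>n. lambert_term n p) - (\<Sum>n. lambert_term n q))
           \<le> norm (p - q) / ((1 - r)\<^sup>2 * (1 - 4 * r))"
proof -
  have r: "0 \<le> r" using assms(1) norm_ge_zero order_trans by blast
  have "(\<Sum>n. lambert_term n p) - (\<Sum>n. lambert_term n q)
      = (\<Sum>n. lambert_term n p - lambert_term n q)"
    using assms by (intro suminf_diff summable_norm_cancel[OF summable_norm_lambert[of _ r]]) auto
  moreover have "(\<lambda>n. norm (p - q) / (1 - r)\<^sup>2 * (4 * r) ^ n)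
      sums (norm (p - q) / (1 - r)\<^sup>2 * (1 / (1 - 4 * r)))"
    using assms r by (intro sums_mult geometric_sums) auto
  hence "norm (\<Sum>n. lambert_term n p - lambert_term n q)
      \<le> norm (p - q) / (1 - r)\<^sup>2 * (1 / (1 - 4 * r))"
    using norm_suminf_le[of "\<lambda>n. lambert_term n p - lambert_term n q",
        OF norm_lambert_term_diff_le[OF assms(1,2)]] assms(3)
    unfolding sums_iff by simp
  ultimately show ?thesis by simp
qed

section \<open>Bounds for the nome\<close>

lemma norm_nome: "norm (nome z) = exp (- (2 * pi * Im z))"
  by (simp add: nome_def norm_exp_eq_Re)

lemma exp_ge_power: "(13/8) ^ n \<le> exp (real n / 2)"
proof -
  \<comment> \<open>13/8 = 1 + 1/2 + 1/8 is the quadratic Taylor polynomial of \<open>exp\<close> at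
    1/2.\<close>
  have "(13/8 :: real) \<le> exp (1/2)"
    using exp_lower_Taylor_quadratic[of "1/2"] by (simp add: power2_eq_square)
  hence "(13/8) ^ n \<le> exp (1/2 :: real) ^ n"
    by (intro power_mono) auto
  thus ?thesis by (simp flip: exp_of_nat_mult)
qed

lemma norm_nome_le:
  assumes "real n / 2 \<le> 2 * pi * Im z"
  shows "norm (nome z) \<le> (8/13) ^ n"
proof -
  have "norm (nome z) \<le> exp (- (real n / 2))"
    using assms by (simp add: norm_nome)
  also have "\<dots> \<le> inverse ((13/8) ^ n)"
    unfolding exp_minus by (intro le_imp_inverse_le exp_ge_power) auto
  also have "\<dots> = (8/13) ^ n"
    by (simp flip: power_inverse)
  finally show ?thesis .
qed

lemma norm_nome_le_128:
  assumes "4/5 \<le> Im z"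
  shows "norm (nome z) \<le> 1/128"
proof -
  have "3.14 * (4/5) \<le> pi * Im z"
    using assms pi_approx by (intro mult_mono) auto
  \<comment> \<open>The exponent fits because 2 * 3.14 * 4/5 = 5.024 exceeds 10/2.\<close>
  hence "norm (nome z) \<le> (8/13) ^ 10"
    by (intro norm_nome_le) auto
  also have "\<dots> \<le> (1/128 :: real)" by (simp add: divide_simps)
  finally show ?thesis .
qed

lemma norm_nome_le_1000:
  assumes "3/2 \<le> Im z"
  shows "norm (nome z) \<le> 1/1000"
proof -
  have "3.14 * (3/2) \<le> pi * Im z"
    using assms pi_approx by (intro mult_mono) auto
  \<comment> \<open>Here 2 * 3.14 * 3/2 = 9.42 exceeds 18/2.\<close>
  hence "norm (nome z) \<le> (8/13) ^ 18"
    by (intro norm_nome_le) auto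
  also have "\<dots> \<le> (1/1000 :: real)" by (simp add: divide_simps)
  finally show ?thesis .
qed

text \<open>Mean value inequality on a convex half plane, where the derivative has norm at most 2 pi
  / 1000.\<close>

lemma norm_nome_diff_le:
  assumes "3/2 \<le> Im z" "3/2 \<le> Im w"
  shows "norm (nome z - nome w) \<le> pi / 500 * norm (z - w)"
proof (rule field_differentiable_bound[of "{z. Im z \<ge> 3/2}" nome "\<lambda>z. 2 * of_real pi * \<i> * nome z"])
  show "convex {z. Im z \<ge> 3/2}" by (rule convex_halfspace_Im_ge)
next
  fix x assume "x \<in> {z. Im z \<ge> 3/2}"
  thus "norm (2 * of_real pi * \<i> * nome x) \<le> pi / 500"
    using norm_nome_le_1000[of x] by (simp add: norm_mult)
  show "(nome has_field_derivative 2 * of_real pi * \<i> * nome x) (at x within {z. Im z \<ge> 3/2})"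
    unfolding nome_def by (auto intro!: derivative_eq_intros)
qed (use assms in auto)

section \<open>Bounds for \<open>E\<^sub>2\<close>\<close>

lemma norm_E2_minus_one_le:
  assumes "4/5 \<le> Im z"
  shows "norm (E2 z - 1) \<le> 1/5"
proof -
  \<comment> \<open>Multiplied by 24, this bound is 3072/16002, just below 1/5.\<close>
  have "norm (\<Sum>n. lambert_term n (nome z)) \<le> (1/128) / ((1 - 1/128) * (1 - 2 * (1/128)))"
    using norm_nome_le_128[OF assms] by (intro norm_lambert_le) auto
  thus ?thesis by (simp add: E2_eq_lambert norm_mult)
qed

lemma norm_E2_ge:
  assumes "4/5 \<le> Im z"
  shows "4/5 \<le> norm (E2 z)"
  using norm_E2_minus_one_le[OF assms] norm_triangle_ineq2[of 1 "1 - E2 z"]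
  by (simp add: norm_minus_commute)

lemma norm_E2_diff_le:
  assumes "3/2 \<le> Im z" "3/2 \<le> Im w"
  shows "norm (E2 z - E2 w) \<le> pi / 20 * norm (z - w)"
proof -
  have "E2 z - E2 w = 24 * ((\<Sum>n. lambert_term n (nome w)) - (\<Sum>n. lambert_term n (nome z)))"
    by (simp add: E2_eq_lambert)
  hence "norm (E2 z - E2 w)
      = 24 * norm ((\<Sum>n. lambert_term n (nome w)) - (\<Sum>n. lambert_term n (nome z)))"
    by (simp only: norm_mult norm_numeral)
  also have "\<dots> \<le> 24 * (norm (nome w - nome z) / ((1 - 1/1000)\<^sup>2 * (1 - 4 * (1/1000))))"
    using norm_nome_le_1000 assms by (intro mult_left_mono norm_lambert_diff_le) auto
  also have "\<dots> \<le> 25 * norm (nome w - nome z)"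
    using norm_ge_zero[of "nome w - nome z"] by (simp add: power2_eq_square)
  also have "\<dots> \<le> 25 * (pi / 500 * norm (w - z))"
    using assms by (intro mult_left_mono norm_nome_diff_le) auto
  finally show ?thesis by (simp add: norm_minus_commute)
qed

lemma lambert_of_real:
  assumes "\<bar>s\<bar> < 1/2"
  shows "(\<Sum>n. lambert_term n (of_real s)) \<in> \<real>"
proof -
  have "Im (\<Sum>n. lambert_term n (of_real s)) = (\<Sum>n. Im (lambert_term n (of_real s)))"
    using assms by (intro Im_suminf summable_norm_cancel[OF summable_norm_lambert[of _ "\<bar>s\<bar>"]]) auto
  also have "(\<lambda>n. Im (lambert_term n (of_real s))) = (\<lambda>n. 0)"
    unfolding lambert_term_def fun_eq_iff complex_is_Real_iff[symmetric]
    by (intro allI Reals_divide Reals_mult Reals_diff Reals_power) auto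
  finally show ?thesis by (simp add: complex_is_Real_iff)
qed

text \<open>On these two lines the factor exp(2 pi i Re z) equals -1, so the nome is a negative real
  number.\<close>

lemma nome_half_integer_line:
  assumes "\<bar>Re z\<bar> = 1/2"
  shows "nome z = of_real (- exp (- (2 * pi * Im z)))"
proof -
  have "Re z = 1/2 \<or> Re z = -(1/2)" using assms by linarith
  hence "cos (2 * pi * Re z) = -1" "sin (2 * pi * Re z) = 0" by (elim disjE; simp only:; simp)+
  thus ?thesis
    by (simp add: nome_def complex_eq_iff Re_exp Im_exp)
qed

lemma E2_half_integer_line_real:
  assumes "\<bar>Re z\<bar> = 1/2" "4/5 \<le> Im z"
  shows "E2 z \<in> \<real>"
proof -
  have "\<bar>- exp (- (2 * pi * Im z))\<bar> < 1/2"
    using norm_nome_le_128[OF assms(2)] by (simp add: norm_nome)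
  from lambert_of_real[OF this] show ?thesis
    unfolding E2_eq_lambert nome_half_integer_line[OF assms(1)]
    by (intro Reals_diff Reals_mult) auto
qed

section \<open>The displacement \<open>f(z) - z\<close>\<close>

definition displacement :: "complex \<Rightarrow> complex" where
  "displacement z = - (6 * \<i> / (of_real pi * E2 z))"

lemma f_E2_eq: "f_E2 z = z + displacement z"
  by (simp add: f_E2_def displacement_def)

lemma norm_displacement_diff_le:
  assumes "3/2 \<le> Im z" "3/2 \<le> Im w"
  shows "norm (displacement z - displacement w) \<le> 1/2 * norm (z - w)"
proof -
  have ge: "4/5 \<le> norm (E2 z)" "4/5 \<le> norm (E2 w)"
    using norm_E2_ge assms by auto
  hence nz: "E2 z \<noteq> 0" "E2 w \<noteq> 0" by auto
  have "displacement z - displacement w = 6 * \<i> / of_real pi * ((E2 z - E2 w) / (E2 z * E2 w))"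
    using nz by (simp add: displacement_def field_simps)
  hence "norm (displacement z - displacement w)
      = 6 / pi * (norm (E2 z - E2 w) / (norm (E2 z) * norm (E2 w)))"
    by (simp add: norm_mult norm_divide)
  also have "\<dots> \<le> 6 / pi * ((pi / 20 * norm (z - w)) / (4/5 * (4/5)))"
    using ge norm_E2_diff_le[OF assms] by (intro mult_left_mono frac_le mult_mono) auto
  \<comment> \<open>The factor pi cancels: (6/pi) (pi/20) (25/16) = 15/32.\<close>
  also have "\<dots> = 15/32 * norm (z - w)" by simp
  also have "\<dots> \<le> 1/2 * norm (z - w)" by (intro mult_right_mono) auto
  finally show ?thesis .
qed

text \<open>Inversion maps the disc of radius \<open>d\<close> about 1 to the disc with diameter
  from 1/(1+d) to 1/(1-d), whose leftmost point is the bound.\<close>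

lemma Re_inverse_ge:
  assumes "norm (w - 1) \<le> d" "d < 1"
  shows "1 / (1 + d) \<le> Re (inverse w)"
proof -
  have d: "0 \<le> d" using assms(1) norm_ge_zero order_trans by blast
  have a: "Re w \<le> 1 + d" using abs_Re_le_cmod[of "w - 1"] assms(1) by simp
  have w: "w \<noteq> 0" using assms by auto
  have "(norm (w - 1))\<^sup>2 \<le> d\<^sup>2" using assms(1) by (intro power_mono) auto
  hence "(norm w)\<^sup>2 \<le> d\<^sup>2 - 1 + 2 * Re w"
    by (simp add: cmod_power2 power2_diff)
  also have "\<dots> \<le> (1 + d) * Re w"
    using mult_right_mono[OF a, of "1 - d"] assms(2) by (simp add: algebra_simps power2_eq_square)
  finally have "1 / (1 + d) \<le> Re w / (norm w)\<^sup>2"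
    using w d by (simp add: field_simps)
  thus ?thesis by (simp add: cmod_power2)
qed

text \<open>With d = 1/5 the bound is (6/pi) (5/6) = 5/pi, which exceeds 3/2. It serves twice: to
  push the real points of \<open>f_E2\<close> up to height 3/2, and to make the fixed point map
  preserve that half plane.\<close>

lemma Im_displacement_le:
  assumes "4/5 \<le> Im z"
  shows "Im (displacement z) \<le> -3/2"
proof -
  have *: "5/6 \<le> Re (inverse (E2 z))"
    using Re_inverse_ge[OF norm_E2_minus_one_le[OF assms]] by simp
  have "displacement z = of_real (6/pi) * (- \<i> * inverse (E2 z))"
    by (simp add: displacement_def field_simps)
  hence "Im (displacement z) = - (6/pi * Re (inverse (E2 z)))"
    by (simp only: Im_complex_of_real Re_complex_of_real times_complex.sel) simp
  moreover have "6/pi * (5/6) \<le> 6/pi * Re (inverse (E2 z))"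
    using * by (intro mult_left_mono) auto
  moreover have "3/2 \<le> 6/pi * (5/6)"
    using pi_approx by (simp add: field_simps)
  ultimately show ?thesis by linarith
qed

lemma Re_displacement_half_integer_line:
  assumes "\<bar>Re z\<bar> = 1/2" "4/5 \<le> Im z"
  shows "Re (displacement z) = 0"
proof -
  obtain e where "E2 z = of_real e"
    using E2_half_integer_line_real[OF assms] by (auto elim: Reals_cases)
  hence "displacement z = of_real (- 6 / (pi * e)) * \<i>"
    by (simp add: displacement_def)
  thus ?thesis by simp
qed

lemma abs_Re_displacement_le:
  assumes "3/2 \<le> Im z" "\<bar>a\<bar> = 1/2"
  shows "\<bar>Re (displacement z)\<bar> \<le> 1/2 * \<bar>Re z - a\<bar>"
proof -
  \<comment> \<open>The point of the same height on the line Re = a, where the displacement is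
    purely imaginary.\<close>
  let ?w = "Complex a (Im z)"
  have "Re (displacement ?w) = 0"
    using assms by (intro Re_displacement_half_integer_line) auto
  hence "\<bar>Re (displacement z)\<bar> \<le> norm (displacement z - displacement ?w)"
    using abs_Re_le_cmod[of "displacement z - displacement ?w"] by simp
  also have "\<dots> \<le> 1/2 * norm (z - ?w)"
    using assms by (intro norm_displacement_diff_le) auto
  also have "norm (z - ?w) = \<bar>Re z - a\<bar>"
    by (simp add: cmod_def)
  finally show ?thesis .
qed

text \<open>The real part moves by at most half its distance to either line Re = 1/2 or Re = -1/2,
  so it crosses neither of them, whether it starts inside or outside the strip.\<close>

lemma abs_Re_f_E2_le_half_iff:
  assumes "3/2 \<le> Im z"
  shows "\<bar>Re (f_E2 z)\<bar> \<le> 1/2 \<longleftrightarrow> \<bar>Re z\<bar> \<le> 1/2"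
proof -
  have "\<bar>Re (displacement z)\<bar> \<le> 1/2 * \<bar>Re z - 1/2\<bar>"
    using assms by (intro abs_Re_displacement_le) auto
  moreover have "\<bar>Re (displacement z)\<bar> \<le> 1/2 * \<bar>Re z - (-1/2)\<bar>"
    using assms by (intro abs_Re_displacement_le) auto
  ultimately show ?thesis
    unfolding f_E2_eq plus_complex.sel by argo
qed

lemma f_E2_real_preimage:
  fixes t :: real
  obtains z where "3/2 \<le> Im z" "f_E2 z = of_real t"
proof -
  let ?S = "{z. Im z \<ge> 3/2}" and ?T = "\<lambda>z. of_real t - displacement z"
  have "\<exists>!z\<in>?S. ?T z = z"
  proof (rule Banach_fix)
    show "complete ?S"
      using closed_halfspace_Im_ge[of "3/2"] by (simp only: complete_eq_closed)
    have "Complex 0 (3/2) \<in> ?S" by simp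
    thus "?S \<noteq> {}" by blast
    show "?T ` ?S \<subseteq> ?S"
    proof (intro image_subsetI)
      fix z assume "z \<in> ?S"
      \<comment> \<open>As \<open>t\<close> is real, the image has imaginary part
        \<open>- Im (displacement z)\<close>, which is at least 3/2.\<close>
      thus "?T z \<in> ?S" using Im_displacement_le[of z] by simp
    qed
    show "dist (?T z) (?T w) \<le> 1/2 * dist z w" if "z \<in> ?S" "w \<in> ?S" for z w
      using norm_displacement_diff_le[of w z] that
      by (simp add: dist_norm norm_minus_commute)
  qed auto
  then obtain z where "3/2 \<le> Im z" "of_real t - displacement z = z" by auto
  thus ?thesis using that[of z] by (simp add: f_E2_eq algebra_simps)
qed

section \<open>The closed fundamental domain\<close>

lemma fund_dom_closure_subset:
  "fund_dom_closure \<subseteq> {z. 4/5 \<le> Im z \<and> \<bar>Re z\<bar> \<le> 1/2}"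
proof
  fix z assume "z \<in> fund_dom_closure"
  hence z: "0 < Im z" "z \<in> closure fund_dom"
    using closure_mono[of "upper_half_plane \<inter> fund_dom" fund_dom]
    by (auto simp: fund_dom_closure_def closure_of_subtopology upper_half_plane_def)
  have "closed {z. 1 \<le> norm z \<and> -1/2 \<le> Re z \<and> Re z \<le> 1/2}"
    by (intro closed_Collect_conj closed_Collect_le continuous_intros)
  moreover have "fund_dom \<subseteq> {z. 1 \<le> norm z \<and> -1/2 \<le> Re z \<and> Re z \<le> 1/2}"
    by (auto simp: fund_dom_def)
  ultimately have "z \<in> {z. 1 \<le> norm z \<and> -1/2 \<le> Re z \<and> Re z \<le> 1/2}"
    using closure_minimal z(2) by blast
  hence n: "1 \<le> norm z" "\<bar>Re z\<bar> \<le> 1/2" by auto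
  have "1 \<le> (Re z)\<^sup>2 + (Im z)\<^sup>2"
    using power_mono[OF n(1), of 2] by (simp add: cmod_power2)
  moreover have "(Re z)\<^sup>2 \<le> (1/2)\<^sup>2"
    using n(2) by (intro abs_le_square_iff[THEN iffD1]) auto
  \<comment> \<open>1 - 1/4 = 3/4 is at least 16/25; thus 4/5 is a rational lower bound for the
    corner height sqrt(3)/2.\<close>
  ultimately have "(4/5)\<^sup>2 \<le> (Im z)\<^sup>2" by (simp add: power2_eq_square)
  hence "4/5 \<le> Im z" using z(1) power2_le_imp_le by fastforce
  thus "z \<in> {z. 4/5 \<le> Im z \<and> \<bar>Re z\<bar> \<le> 1/2}" using n by simp
qed

lemma in_fund_dom_closure:
  assumes "1 < Im z" "\<bar>Re z\<bar> \<le> 1/2"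
  shows "z \<in> fund_dom_closure"
proof -
  have "z \<in> closure fund_dom"
    unfolding closure_approachable
  proof (intro allI impI)
    fix e :: real assume "0 < e"
    define d where "d = min (e/2) (1/2)"
    \<comment> \<open>Above height 1 the strip differs from \<open>fund_dom\<close> only along Re z
      = 1/2, so points there are shifted left; \<open>d\<close> at most 1/2 keeps the real part of
      \<open>w\<close> nonnegative.\<close>
    define w where "w = (if Re z = 1/2 then z - of_real d else z)"
    have d: "0 < d" "d < e" "d \<le> 1/2" using \<open>0 < e\<close> by (auto simp: d_def)
    have "1 < norm w"
      using assms(1) abs_Im_le_cmod[of w] by (auto simp: w_def split: if_splits)
    hence "w \<in> fund_dom"
      using assms d by (auto simp: fund_dom_def upper_half_plane_def w_def)
    moreover have "dist w z < e"
      using d \<open>0 < e\<close> by (auto simp: w_def dist_norm)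
    ultimately show "\<exists>y\<in>fund_dom. dist y z < e" by blast
  qed
  moreover have "upper_half_plane \<inter> fund_dom = fund_dom"
    by (auto simp: fund_dom_def)
  ultimately show ?thesis
    using assms by (simp add: fund_dom_closure_def closure_of_subtopology upper_half_plane_def)
qed

theorem theorem2p1:
  shows "f_E2 ` A_set = complex_of_real ` {-1/2..1/2}"
proof (intro equalityI subsetI)
  fix y assume "y \<in> f_E2 ` A_set"
  then obtain z where z: "z \<in> fund_dom_closure" "Im (f_E2 z) = 0" "y = f_E2 z"
    by (auto simp: A_set_def)
  have zz: "4/5 \<le> Im z" "\<bar>Re z\<bar> \<le> 1/2" using z(1) fund_dom_closure_subset by auto
  \<comment> \<open>Since \<open>f_E2 z\<close> is real, \<open>Im z\<close> is the negative of the
    imaginary part of the displacement.\<close>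
  have "3/2 \<le> Im z"
    using Im_displacement_le[OF zz(1)] z(2) by (simp add: f_E2_eq)
  hence "\<bar>Re y\<bar> \<le> 1/2" using abs_Re_f_E2_le_half_iff zz z(3) by simp
  moreover have "y = of_real (Re y)" using z by (simp add: complex_eq_iff)
  ultimately show "y \<in> complex_of_real ` {-1/2..1/2}"
    by (intro image_eqI[of _ _ "Re y"]) auto
next
  fix y assume "y \<in> complex_of_real ` {-1/2..1/2}"
  then obtain t where t: "y = of_real t" "\<bar>t\<bar> \<le> 1/2" by auto
  obtain z where z: "3/2 \<le> Im z" "f_E2 z = of_real t" by (rule f_E2_real_preimage)
  have "\<bar>Re z\<bar> \<le> 1/2" using abs_Re_f_E2_le_half_iff[OF z(1)] z(2) t(2) by simp
  hence "z \<in> A_set" using z by (simp add: A_set_def in_fund_dom_closure)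
  thus "y \<in> f_E2 ` A_set" using z(2) t(1) by (intro image_eqI[of _ _ z]) auto
qed

end
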